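(* Let $h\geq 3$ be an integer and let $A$ be a finite set of $k\geq 3$ positive integers. Then \[|h_{\pm}A| \geq 2hk-h+1.\] This lower bound is best possible: for $A=\{1,3,5,\ldots,2k-1\}$ one has $|h_{\pm}A| = 2hk-h+1$.
   Context: For a finite set $A=\{a_0,a_1,\ldots,a_{k-1}\}$ of integers and a positive integer $h$, the $h$-fold signed sumset of $A$ is \[h_{\pm}A=\Big\{\sum_{i=0}^{k-1}\lambda_i a_i : (\lambda_0,\ldots,\lambda_{k-1})\in\mathbb{Z}^k,\ \sum_{i=0}^{k-1}|\lambda_i|=h\Big\}.\] *)

theory Defs
  imports Main
begin

text \<open>The coefficients are indexed by the elements of \<open>A\<close> themselves,
  so \<open>l a\<close> plays the role of \<open>\<lambda>\<^sub>i\<close> for \<open>a = a\<^sub>i\<close>; the values of \<open>l\<close> outside \<open>A\<close> are irrelevant.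
  The notion is intended for finite \<open>A\<close> only.\<close>

definition signed_sumset :: "nat \<Rightarrow> int set \<Rightarrow> int set" where
  "signed_sumset h A = {(\<Sum>a\<in>A. l a * a) | l :: int \<Rightarrow> int. (\<Sum>a\<in>A. \<bar>l a\<bar>) = int h}"

end

theory Submission
  imports Defs
begin

text \<open>
  Moving one summand at a time from the largest element \<open>m\<close> of \<open>A\<close> to a new maximum \<open>M\<close> gives
  \<open>h\<close> sums above \<open>h m\<close>, and by symmetry \<open>h\<close> sums below \<open>- h m\<close>; so it suffices to find
  \<open>5 h + 1\<close> sums for \<open>A = {a < b < c}\<close>.

  If \<open>a, b, c\<close> is not an arithmetic progression, the sums with nonnegative coefficients already
  take \<open>3 h\<close> positive values. Otherwise, let \<open>d\<close> be the common difference; the numbers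
  \<open>h a + j d\<close> with \<open>0 \<le> j \<le> 2 h\<close> are sums. If \<open>d\<close> does not divide \<open>2 a\<close>, the sums in which
  \<open>a\<close> has coefficient \<open>- 1\<close> and \<open>b\<close>, \<open>c\<close> have nonnegative coefficients give \<open>h\<close> positive values
  in another residue class modulo \<open>d\<close>. If \<open>2 a = m d\<close>, then \<open>h - 1\<close> further sums lie strictly
  between \<open>- h a\<close> and \<open>h a\<close>: they are of the form \<open>- h a + (x (m + 1) + z) d\<close> with
  \<open>0 \<le> z \<le> x \<le> h\<close>, where \<open>x\<close> counts the summands different from \<open>- a\<close> and \<open>z\<close> those equal
  to \<open>c\<close>.
\<close>

section \<open>Signed sumsets\<close>

lemma signed_sumset_uminus:
  assumes "x \<in> signed_sumset h A"
  shows "- x \<in> signed_sumset h A"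
proof -
  obtain l where l: "x = (\<Sum>a\<in>A. l a * a)" "(\<Sum>a\<in>A. \<bar>l a\<bar>) = int h"
    using assms by (auto simp: signed_sumset_def)
  have "- x = (\<Sum>a\<in>A. (- l a) * a) \<and> (\<Sum>a\<in>A. \<bar>- l a\<bar>) = int h"
    using l by (simp add: sum_negf)
  then show ?thesis
    unfolding signed_sumset_def mem_Collect_eq by (intro exI[of _ "\<lambda>a. - l a"])
qed

lemma signed_sumset_mono:
  assumes "finite B" "A \<subseteq> B"
  shows "signed_sumset h A \<subseteq> signed_sumset h B"
proof
  fix x assume "x \<in> signed_sumset h A"
  then obtain l where l: "x = (\<Sum>a\<in>A. l a * a)" "(\<Sum>a\<in>A. \<bar>l a\<bar>) = int h"
    by (auto simp: signed_sumset_def)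
  define l' where "l' a = (if a \<in> A then l a else 0)" for a
  have "(\<Sum>a\<in>B. l' a * a) = (\<Sum>a\<in>A. l a * a)"
    by (rule sum.mono_neutral_cong_right) (use assms in \<open>auto simp: l'_def\<close>)
  moreover have "(\<Sum>a\<in>B. \<bar>l' a\<bar>) = (\<Sum>a\<in>A. \<bar>l a\<bar>)"
    by (rule sum.mono_neutral_cong_right) (use assms in \<open>auto simp: l'_def\<close>)
  ultimately have "x = (\<Sum>a\<in>B. l' a * a) \<and> (\<Sum>a\<in>B. \<bar>l' a\<bar>) = int h"
    using l by simp
  then show "x \<in> signed_sumset h B"
    unfolding signed_sumset_def mem_Collect_eq by (intro exI[of _ l'])
qed

lemma signed_sumset_abs_le:
  assumes "x \<in> signed_sumset h A" and "\<And>a. a \<in> A \<Longrightarrow> \<bar>a\<bar> \<le> M"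
  shows "\<bar>x\<bar> \<le> int h * M"
proof -
  obtain l where l: "x = (\<Sum>a\<in>A. l a * a)" "(\<Sum>a\<in>A. \<bar>l a\<bar>) = int h"
    using assms by (auto simp: signed_sumset_def)
  have "\<bar>x\<bar> \<le> (\<Sum>a\<in>A. \<bar>l a * a\<bar>)"
    unfolding l by (rule sum_abs)
  also have "\<dots> \<le> (\<Sum>a\<in>A. \<bar>l a\<bar> * M)"
    by (rule sum_mono) (simp add: abs_mult assms(2) mult_left_mono)
  also have "\<dots> = int h * M"
    using l by (simp add: sum_distrib_right[symmetric])
  finally show ?thesis .
qed

lemma finite_signed_sumset:
  assumes "finite A"
  shows "finite (signed_sumset h A)"
proof (rule finite_subset)
  define M where "M = (\<Sum>a\<in>A. \<bar>a\<bar>)"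
  have "\<bar>a\<bar> \<le> M" if "a \<in> A" for a
    unfolding M_def using assms that by (intro member_le_sum) auto
  from signed_sumset_abs_le[OF _ this]
  show "signed_sumset h A \<subseteq> {- (int h * M)..int h * M}"
    by force
qed simp

lemma signed_sumset_doubleton:
  assumes "a \<noteq> b" "\<bar>i\<bar> + \<bar>j\<bar> = int h"
  shows "i * a + j * b \<in> signed_sumset h {a, b}"
  unfolding signed_sumset_def mem_Collect_eq using assms
  by (intro exI[of _ "\<lambda>x. if x = a then i else j"]) auto

lemma signed_sumset_triple:
  assumes "a < b" "b < c" "\<bar>i\<bar> + \<bar>j\<bar> + \<bar>l\<bar> = int h"
  shows "i * a + j * b + l * c \<in> signed_sumset h {a, b, c}"
  unfolding signed_sumset_def mem_Collect_eq using assms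
  by (intro exI[of _ "\<lambda>x. if x = a then i else if x = b then j else l"]) auto

lemma card_Un_uminus_image:
  fixes X :: "int set"
  assumes "finite X" "\<And>x. x \<in> X \<Longrightarrow> x > 0"
  shows "card (X \<union> uminus ` X) = 2 * card X"
proof -
  have "- x \<notin> X" if "x \<in> X" for x
    using assms(2)[OF that] assms(2)[of "- x"] by linarith
  then have "X \<inter> uminus ` X = {}"
    by blast
  then show ?thesis
    using assms(1) by (simp add: card_Un_disjoint card_image)
qed

lemma signed_sumset_card_ge_double:
  assumes "finite A" "X \<subseteq> signed_sumset h A" "\<And>x. x \<in> X \<Longrightarrow> x > 0"
  shows "2 * card X \<le> card (signed_sumset h A)"
proof -
  have fin: "finite X"
    using assms finite_signed_sumset finite_subset by blast
  have "card (X \<union> uminus ` X) = 2 * card X"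
    using fin assms(3) by (rule card_Un_uminus_image)
  moreover have "X \<union> uminus ` X \<subseteq> signed_sumset h A"
    using assms(2) signed_sumset_uminus by auto
  ultimately show ?thesis
    using card_mono[OF finite_signed_sumset[OF assms(1)]] by metis
qed

text \<open>All sums over \<open>A\<close> have absolute value at most \<open>int h * m\<close>, so
  the \<open>h\<close> mixed sums of \<open>m\<close> and \<open>M\<close> above this bound and
  their negatives below its negative are new. This is the inductive step of the general
  bound.\<close>

lemma signed_sumset_insert_max:
  assumes "finite A" "m \<in> A" "0 < m" "m < M" "\<And>a. a \<in> A \<Longrightarrow> \<bar>a\<bar> \<le> m"
  shows "card (signed_sumset h A) + 2 * h \<le> card (signed_sumset h (insert M A))"
proof -
  define g where "g j = (int h - int j) * m + int j * M" for j
  define X where "X = g ` {1..h}"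
  have g: "g j = int h * m + int j * (M - m)" for j
    by (simp add: g_def algebra_simps)
  have "inj_on g {1..h}"
    using assms(4) by (auto simp: inj_on_def g)
  then have card_X: "card X = h"
    by (simp add: X_def card_image)
  have gt: "x > int h * m" if "x \<in> X" for x
    using that assms(4) by (auto simp: X_def g)
  have nonneg: "0 \<le> int h * m"
    using assms(3) by simp
  have "X \<subseteq> signed_sumset h {m, M}"
    using signed_sumset_doubleton[of m M] assms(4) by (auto simp: X_def g_def)
  also have "\<dots> \<subseteq> signed_sumset h (insert M A)"
    using assms by (intro signed_sumset_mono) auto
  finally have sub: "X \<subseteq> signed_sumset h (insert M A)" .
  have sub': "signed_sumset h A \<union> (X \<union> uminus ` X) \<subseteq> signed_sumset h (insert M A)"
    using sub signed_sumset_uminus signed_sumset_mono[of "insert M A" A h] assms(1) by auto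
  have fin: "finite X"
    by (simp add: X_def)
  have "card (X \<union> uminus ` X) = 2 * h"
    using card_Un_uminus_image[OF fin] gt nonneg card_X by force
  moreover have "signed_sumset h A \<inter> (X \<union> uminus ` X) = {}"
    using signed_sumset_abs_le[of _ h A m] assms(5) gt by force
  ultimately have "card (signed_sumset h A \<union> (X \<union> uminus ` X)) = card (signed_sumset h A) + 2 * h"
    using fin finite_signed_sumset[OF assms(1)] by (simp add: card_Un_disjoint)
  then show ?thesis
    using card_mono[OF finite_signed_sumset sub'] assms(1) by simp
qed

section \<open>Three elements\<close>

definition nonneg_sums :: "nat \<Rightarrow> int \<Rightarrow> int \<Rightarrow> int \<Rightarrow> int set" where
  "nonneg_sums h a b c = {int i * a + int j * b + int l * c | i j l. i + j + l = h}"

lemma nonneg_sumsI: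
  "i + j + l = h \<Longrightarrow> int i * a + int j * b + int l * c \<in> nonneg_sums h a b c"
  unfolding nonneg_sums_def by blast

lemma finite_nonneg_sums: "finite (nonneg_sums h a b c)"
proof (rule finite_subset)
  show "nonneg_sums h a b c \<subseteq>
      (\<lambda>(i, j, l). int i * a + int j * b + int l * c) ` ({..h} \<times> {..h} \<times> {..h})"
    unfolding nonneg_sums_def by (force simp: image_iff)
qed simp

text \<open>Negating the triple swaps its two gaps while preserving the number of sums, so only
  triples whose first gap is the larger need a direct count.\<close>

lemma nonneg_sums_uminus: "nonneg_sums h (- c) (- b) (- a) = uminus ` nonneg_sums h a b c"
proof -
  have "x \<in> nonneg_sums h (- c) (- b) (- a) \<longleftrightarrow> - x \<in> nonneg_sums h a b c" for x
    unfolding nonneg_sums_def mem_Collect_eq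
  proof (intro iffI; elim exE conjE)
    fix i j l assume *: "x = int i * - c + int j * - b + int l * - a" "i + j + l = h"
    then have "- x = int l * a + int j * b + int i * c \<and> l + j + i = h"
      by simp
    then show "\<exists>i j l. - x = int i * a + int j * b + int l * c \<and> i + j + l = h"
      by blast
  next
    fix i j l assume *: "- x = int i * a + int j * b + int l * c" "i + j + l = h"
    then have "x = int l * - c + int j * - b + int i * - a \<and> l + j + i = h"
      by simp
    then show "\<exists>i j l. x = int i * - c + int j * - b + int l * - a \<and> i + j + l = h"
      by blast
  qed
  then have "nonneg_sums h (- c) (- b) (- a) = uminus -` nonneg_sums h a b c"
    by blast
  also have "\<dots> = uminus ` nonneg_sums h a b c"
    by (force simp: vimage_def image_iff)
  finally show ?thesis .
qed

text \<open>Since \<open>2 b > a + c\<close>, the three largest of the \<open>h\<close>-fold sums of \<open>a\<close>, \<open>b\<close>, \<open>c\<close>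
  exceed the translate by \<open>a\<close> of the \<open>(h - 1)\<close>-fold sums.\<close>

lemma card_nonneg_sums_decreasing_gaps:
  assumes "a < b" "b < c" "c - b < b - a"
  shows "3 * Suc h \<le> card (nonneg_sums (Suc h) a b c)"
proof (induction h)
  case 0
  have "{a, b, c} \<subseteq> nonneg_sums (Suc 0) a b c"
    using nonneg_sumsI[of 1 0 0 "Suc 0" a b c] nonneg_sumsI[of 0 1 0 "Suc 0" a b c]
      nonneg_sumsI[of 0 0 1 "Suc 0" a b c] by simp
  then have "card {a, b, c} \<le> card (nonneg_sums (Suc 0) a b c)"
    by (rule card_mono[OF finite_nonneg_sums])
  then show ?case
    using assms by simp
next
  case (Suc h)
  define T where "T = (\<lambda>x. x + a) ` nonneg_sums (Suc h) a b c"
  define N where "N = (\<lambda>s. int h * c + s) ` {2 * b, b + c, 2 * c}"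
  have le: "x \<le> int (Suc h) * c" if x: "x \<in> nonneg_sums (Suc h) a b c" for x
  proof -
    obtain i j l where "x = int i * a + int j * b + int l * c" "i + j + l = Suc h"
      using x unfolding nonneg_sums_def by blast
    moreover have "int i * a \<le> int i * c" "int j * b \<le> int j * c"
      using assms by (simp_all add: mult_left_mono)
    ultimately have "x \<le> (int i + int j + int l) * c"
      by (simp add: algebra_simps)
    with \<open>i + j + l = Suc h\<close> show ?thesis
      by (metis of_nat_add)
  qed
  have T_sub: "T \<subseteq> nonneg_sums (Suc (Suc h)) a b c"
  proof
    fix y assume "y \<in> T"
    then obtain i j l where "y = int i * a + int j * b + int l * c + a" "i + j + l = Suc h"
      unfolding T_def nonneg_sums_def by blast
    then show "y \<in> nonneg_sums (Suc (Suc h)) a b c"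
      using nonneg_sumsI[of "Suc i" j l "Suc (Suc h)" a b c] by (simp add: algebra_simps)
  qed
  have N_sub: "N \<subseteq> nonneg_sums (Suc (Suc h)) a b c"
    using nonneg_sumsI[of 0 2 h "Suc (Suc h)" a b c]
      nonneg_sumsI[of 0 1 "Suc h" "Suc (Suc h)" a b c]
      nonneg_sumsI[of 0 0 "Suc (Suc h)" "Suc (Suc h)" a b c]
    unfolding N_def by (auto simp: algebra_simps)
  have "card N = 3"
    using assms unfolding N_def by (subst card_image) (auto simp: inj_on_def)
  moreover have "card T = card (nonneg_sums (Suc h) a b c)"
    unfolding T_def by (simp add: card_image)
  moreover have "T \<inter> N = {}"
  proof -
    have "y \<le> int h * c + c + a" if "y \<in> T" for y
      using that le by (force simp: T_def algebra_simps)
    moreover have "y > int h * c + c + a" if "y \<in> N" for y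
      using that assms by (auto simp: N_def)
    ultimately show ?thesis
      by force
  qed
  moreover have "finite T" "finite N"
    using finite_nonneg_sums by (auto simp: T_def N_def)
  ultimately have "card (T \<union> N) = card (nonneg_sums (Suc h) a b c) + 3"
    by (simp add: card_Un_disjoint)
  moreover have "card (T \<union> N) \<le> card (nonneg_sums (Suc (Suc h)) a b c)"
    using T_sub N_sub by (intro card_mono finite_nonneg_sums) auto
  ultimately show ?case
    using Suc.IH by simp
qed

lemma card_nonneg_sums_non_AP:
  assumes "a < b" "b < c" "c - b \<noteq> b - a" "h \<ge> 1"
  shows "3 * h \<le> card (nonneg_sums h a b c)"
proof (cases "c - b < b - a")
  case True
  then show ?thesis
    using card_nonneg_sums_decreasing_gaps[of a b c "h - 1"] assms by simp
next
  case False
  then have "3 * h \<le> card (nonneg_sums h (- c) (- b) (- a))"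
    using card_nonneg_sums_decreasing_gaps[of "- c" "- b" "- a" "h - 1"] assms by simp
  then show ?thesis
    by (simp add: nonneg_sums_uminus card_image)
qed

text \<open>Every sum with nonnegative coefficients is at least \<open>int h * a\<close>, hence
  positive, so these \<open>3 * h\<close> sums and their negatives are all distinct.\<close>

lemma card_signed_sumset_non_AP:
  assumes "0 < a" "a < b" "b < c" "c - b \<noteq> b - a" "h \<ge> 1"
  shows "6 * h \<le> card (signed_sumset h {a, b, c})"
proof -
  have "nonneg_sums h a b c \<subseteq> signed_sumset h {a, b, c}"
    using signed_sumset_triple[OF assms(2,3)] by (force simp: nonneg_sums_def)
  moreover have "x > 0" if x: "x \<in> nonneg_sums h a b c" for x
  proof -
    obtain i j l where x: "x = int i * a + int j * b + int l * c" "i + j + l = h"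
      using x unfolding nonneg_sums_def by blast
    have "int j * a \<le> int j * b" "int l * a \<le> int l * c"
      using assms by (simp_all add: mult_left_mono)
    then have "(int i + int j + int l) * a \<le> x"
      using x by (simp add: algebra_simps)
    moreover have "int i + int j + int l = int h"
      using x by simp
    ultimately have "int h * a \<le> x"
      by simp
    moreover have "0 < int h * a"
      using assms by simp
    ultimately show ?thesis
      by simp
  qed
  ultimately have "2 * card (nonneg_sums h a b c) \<le> card (signed_sumset h {a, b, c})"
    by (intro signed_sumset_card_ge_double) auto
  then show ?thesis
    using card_nonneg_sums_non_AP[OF assms(2-5)] by simp
qed

section \<open>Triples in arithmetic progression\<close>

lemma signed_sumset_AP_nonneg:
  fixes a d j :: int
  assumes "0 < d" "0 \<le> j" "j \<le> 2 * int h"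
  shows "int h * a + j * d \<in> signed_sumset h {a, a + d, a + 2 * d}"
\<comment> \<open>Starting from \<open>h\<close> copies of \<open>a\<close>, the first
  \<open>h\<close> steps turn copies of \<open>a\<close> into \<open>a + d\<close>; each later step
  turns an \<open>a + d\<close> into \<open>a + 2 * d\<close>.\<close>
proof (cases "j \<le> int h")
  case True
  then show ?thesis
    using signed_sumset_triple[of a "a + d" "a + 2 * d" "int h - j" j 0 h] assms
    by (simp add: algebra_simps)
next
  case False
  then show ?thesis
    using signed_sumset_triple[of a "a + d" "a + 2 * d" 0 "2 * int h - j" "j - int h" h] assms
    by (simp add: algebra_simps)
qed

text \<open>From \<open>h\<close> summands \<open>- a\<close>, replace \<open>x\<close> of them:
  \<open>x - z\<close> by \<open>a + d\<close>, a gain of \<open>2 * a + d\<close> each, and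
  \<open>z\<close> by \<open>a + 2 * d\<close>, a gain of \<open>2 * a + 2 * d\<close> each.\<close>

lemma signed_sumset_AP_neg:
  fixes a d x z :: int
  assumes "0 < d" "0 \<le> z" "z \<le> x" "x \<le> int h"
  shows "- (int h * a) + x * (2 * a + d) + z * d \<in> signed_sumset h {a, a + d, a + 2 * d}"
  using signed_sumset_triple[of a "a + d" "a + 2 * d" "- (int h - x)" "x - z" z h] assms
  by (simp add: algebra_simps)

lemma card_signed_sumset_AP_not_dvd:
  assumes "0 < a" "0 < d" "\<not> d dvd 2 * a" "h \<ge> 2"
  shows "6 * h + 2 \<le> card (signed_sumset h {a, a + d, a + 2 * d})"
proof -
  define X where "X = (\<lambda>j. int h * a + j * d) ` {0..2 * int h}"
  \<comment> \<open>This is \<open>signed_sumset_AP_neg\<close> with \<open>x = int h - 1\<close>,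
    so exactly one summand \<open>- a\<close> remains. Modulo \<open>d\<close>, members of
    \<open>X\<close> and \<open>Y\<close> differ by \<open>2 * a\<close>.\<close>
  define Y where "Y = (\<lambda>z. (int h - 2) * a + (int h - 1 + z) * d) ` {0..int h - 1}"
  have "card X = 2 * h + 1"
    unfolding X_def using assms(2) by (subst card_image) (auto simp: inj_on_def)
  moreover have "card Y = h"
    unfolding Y_def using assms(2) by (subst card_image) (auto simp: inj_on_def)
  moreover have "X \<inter> Y = {}"
  proof -
    have False
      if "int h * a + j * d = (int h - 2) * a + (int h - 1 + z) * d" for j z
    proof -
      have "2 * a = d * (int h - 1 + z - j)"
        using that by (simp add: algebra_simps)
      then show False
        using assms(3) by simp
    qed
    then show ?thesis
      unfolding X_def Y_def by blast
  qed
  ultimately have "card (X \<union> Y) = 3 * h + 1"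
    by (subst card_Un_disjoint) (auto simp: X_def Y_def)
  moreover have "X \<subseteq> signed_sumset h {a, a + d, a + 2 * d}"
    using signed_sumset_AP_nonneg[OF assms(2)] by (auto simp: X_def)
  moreover have "Y \<subseteq> signed_sumset h {a, a + d, a + 2 * d}"
  proof -
    have "(int h - 2) * a + (int h - 1 + z) * d \<in> signed_sumset h {a, a + d, a + 2 * d}"
      if "0 \<le> z" "z \<le> int h - 1" for z
      using signed_sumset_AP_neg[of d z "int h - 1" h a] assms(2) that
      by (simp add: algebra_simps)
    then show ?thesis
      by (auto simp: Y_def)
  qed
  moreover have "x > 0" if "x \<in> X \<union> Y" for x
    using that
  proof
    assume "x \<in> X"
    then show ?thesis
      using assms by (auto simp: X_def intro!: add_pos_nonneg)
  next
    assume "x \<in> Y"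
    then show ?thesis
      using assms by (auto simp: Y_def intro!: add_nonneg_pos)
  qed
  ultimately show ?thesis
    using signed_sumset_card_ge_double[of "{a, a + d, a + 2 * d}" "X \<union> Y" h] by simp
qed

text \<open>The \<open>s\<close>-th number below has \<open>x = s div 2\<close> and \<open>z = s mod 2\<close> in the notation of
  the introduction.\<close>

lemma signed_sumset_AP_gap:
  fixes a d m s :: int
  assumes "0 < d" "2 * a = m * d" "2 \<le> s" "s \<le> int h"
  shows "- (int h * a) + (s div 2 * (m + 1) + s mod 2) * d \<in> signed_sumset h {a, a + d, a + 2 * d}"
proof -
  have "- (int h * a) + s div 2 * (m * d + d) + s mod 2 * d
      \<in> signed_sumset h {a, a + d, a + 2 * d}"
    using signed_sumset_AP_neg[of d "s mod 2" "s div 2" h a] assms by simp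
  then show ?thesis
    by (simp add: algebra_simps)
qed

text \<open>Measured from \<open>- (int h * a)\<close> in steps of \<open>d\<close>, the point
  \<open>int h * a\<close> sits at \<open>int h * m\<close>, because \<open>2 * a = m * d\<close>.
  So \<open>N\<close> indexes sums strictly between these two points.\<close>

lemma card_signed_sumset_AP_gap:
  fixes a d m :: int
  assumes "0 < d" "2 * a = m * d" "0 < m" "h \<ge> 3"
  obtains N where "N \<subseteq> {1..int h * m - 1}" "card N = h - 1"
    "\<And>n. n \<in> N \<Longrightarrow> - (int h * a) + n * d \<in> signed_sumset h {a, a + d, a + 2 * d}"
proof (cases "m = 1")
  case True
  have *: "- (int h * a) + n * d \<in> signed_sumset h {a, a + d, a + 2 * d}"
    if "2 \<le> n" "n \<le> int h" for n
  proof -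
    have "n div 2 * (m + 1) + n mod 2 = n"
      using True by simp
    then show ?thesis
      using signed_sumset_AP_gap[OF assms(1,2) that] by metis
  qed
  \<comment> \<open>For \<open>m = 1\<close> the index \<open>int h\<close> is already the right
    endpoint, which leaves only 2 up to \<open>int h - 1\<close>. The missing index 1 is the mirror
    image of \<open>int h - 1\<close>, which is at least 2 since \<open>h \<ge> 3\<close>.\<close>
  have "- (- (int h * a) + (int h - 1) * d) \<in> signed_sumset h {a, a + d, a + 2 * d}"
    using assms(4) by (intro signed_sumset_uminus *) auto
  moreover have "- (- (int h * a) + (int h - 1) * d) = - (int h * a) + 1 * d"
  proof -
    have "d = 2 * a"
      using assms(2) True by simp
    then show ?thesis
      by (simp add: algebra_simps)
  qed
  ultimately have "- (int h * a) + 1 * d \<in> signed_sumset h {a, a + d, a + 2 * d}"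
    by metis
  then have "- (int h * a) + n * d \<in> signed_sumset h {a, a + d, a + 2 * d}"
    if "n \<in> {1..int h * m - 1}" for n
    using * that True by (cases "n = 1") auto
  moreover have "card {1..int h * m - 1} = h - 1"
    using True by simp
  ultimately show ?thesis
    using that by blast
next
  case False
  then have m: "m \<ge> 2"
    using assms(3) by simp
  define f where "f s = s div 2 * (m + 1) + s mod 2" for s :: int
  \<comment> \<open>Consecutive values of \<open>f\<close> increase alternately by 1 and by
    \<open>m\<close>.\<close>
  have f_less: "f s < f t" if "s < t" for s t
  proof (cases "s div 2 = t div 2")
    case True
    then have "s mod 2 < t mod 2"
      using that by presburger
    then show ?thesis
      using True by (simp add: f_def)
  next
    case False
    then have "s div 2 + 1 \<le> t div 2"
      using that by presburger
    then have "(s div 2 + 1) * (m + 1) \<le> t div 2 * (m + 1)"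
      using m by (intro mult_right_mono) auto
    moreover have "s mod 2 \<le> 1" "0 \<le> t mod 2"
      by simp_all
    ultimately show ?thesis
      using m by (simp add: f_def distrib_right)
  qed
  have "inj_on f {2..int h}"
    by (rule inj_onI) (metis f_less less_irrefl linorder_neqE)
  then have "card (f ` {2..int h}) = h - 1"
    by (simp add: card_image)
  moreover have "f ` {2..int h} \<subseteq> {1..int h * m - 1}"
  proof
    fix n assume "n \<in> f ` {2..int h}"
    then obtain s where s: "n = f s" "2 \<le> s" "s \<le> int h"
      by auto
    have "f s > f 0"
      using s f_less by simp
    \<comment> \<open>Twice \<open>f s\<close> is at most \<open>int h * (m + 1) + 2\<close>,
      whereas \<open>2 * int h * m\<close> exceeds \<open>int h * (m + 1)\<close> by
      \<open>int h * (m - 1)\<close>, which is at least 3.\<close>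
    moreover have "f s < int h * m"
    proof -
      have "2 * (s div 2) * (m + 1) \<le> int h * (m + 1)"
        using s m by (intro mult_right_mono) auto
      moreover have "3 * 1 \<le> int h * (m - 1)"
        using assms(4) m by (intro mult_mono) auto
      moreover have "s mod 2 \<le> 1"
        by simp
      moreover have "2 * f s = 2 * (s div 2) * (m + 1) + 2 * (s mod 2)"
        by (simp add: f_def)
      ultimately show ?thesis
        by (simp add: algebra_simps)
    qed
    ultimately show "n \<in> {1..int h * m - 1}"
      using s by (simp add: f_def)
  qed
  moreover have "- (int h * a) + n * d \<in> signed_sumset h {a, a + d, a + 2 * d}"
    if "n \<in> f ` {2..int h}" for n
    using that signed_sumset_AP_gap[OF assms(1,2)] by (auto simp: f_def)
  ultimately show ?thesis
    using that by blast
qed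

text \<open>In the index \<open>n\<close>, the progression from \<open>int h * a\<close> upwards is
  \<open>R\<close>, its reflection is \<open>L\<close>, and \<open>N\<close> lies strictly between.
  The count is \<open>(2 * h + 1) + (h - 1) + (2 * h + 1)\<close>.\<close>

lemma card_signed_sumset_AP_dvd:
  fixes a d m :: int
  assumes "0 < d" "2 * a = m * d" "0 < m" "h \<ge> 3"
  shows "5 * h + 1 \<le> card (signed_sumset h {a, a + d, a + 2 * d})"
proof -
  let ?S = "signed_sumset h {a, a + d, a + 2 * d}"
  define g where "g n = - (int h * a) + n * d" for n
  obtain N where N: "N \<subseteq> {1..int h * m - 1}" "card N = h - 1" "\<And>n. n \<in> N \<Longrightarrow> g n \<in> ?S"
    using card_signed_sumset_AP_gap[OF assms] unfolding g_def by metis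
  define L where "L = {- (2 * int h)..0}"
  define R where "R = {int h * m..int h * m + 2 * int h}"
  have fin: "finite L" "finite N" "finite R"
    using N(1) finite_subset by (auto simp: L_def R_def)
  have pos: "0 < int h * m"
    using assms by simp
  have "card (L \<union> (N \<union> R)) = card L + (card N + card R)"
  proof -
    have "N \<inter> R = {}" "L \<inter> (N \<union> R) = {}"
      using N(1) pos by (force simp: L_def R_def)+
    then show ?thesis
      using fin by (simp add: card_Un_disjoint)
  qed
  also have "\<dots> = 5 * h + 1"
    using N(2) assms(4) by (simp add: L_def R_def)
  also have "card (L \<union> (N \<union> R)) = card (g ` (L \<union> (N \<union> R)))"
    using assms(1) by (intro card_image[symmetric]) (auto simp: inj_on_def g_def)
  finally have card: "card (g ` (L \<union> (N \<union> R))) = 5 * h + 1"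
    by simp
  have "g n \<in> ?S" if "n \<in> L" for n
    using signed_sumset_uminus[OF signed_sumset_AP_nonneg[OF assms(1), of "- n" h a]] that
    by (simp add: L_def g_def)
  moreover have "g n \<in> ?S" if "n \<in> R" for n
  proof -
    have "int h * m * d = int h * a + int h * a"
      using assms(2) by (simp add: mult.assoc flip: assms(2))
    then have "g n = int h * a + (n - int h * m) * d"
      unfolding g_def left_diff_distrib by linarith
    then show ?thesis
      using signed_sumset_AP_nonneg[OF assms(1), of "n - int h * m" h a] that
      by (simp add: R_def)
  qed
  ultimately have "g ` (L \<union> (N \<union> R)) \<subseteq> ?S"
    using N(3) by blast
  then show ?thesis
    using card card_mono[OF finite_signed_sumset] by (metis finite.emptyI finite_insert)
qed

lemma card_signed_sumset_triple:
  assumes "0 < a" "a < b" "b < c" "h \<ge> 3"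
  shows "5 * h + 1 \<le> card (signed_sumset h {a, b, c})"
proof (cases "c - b = b - a")
  case False
  then show ?thesis
    using card_signed_sumset_non_AP[OF assms(1-3), of h] assms(4) by simp
next
  case True
  define d where "d = b - a"
  have d: "0 < d" "b = a + d" "c = a + 2 * d"
    using assms True by (auto simp: d_def)
  show ?thesis
  proof (cases "d dvd 2 * a")
    case True
    then obtain m where m: "2 * a = m * d"
      by (auto simp: dvd_def mult.commute)
    then have "0 < m"
      using assms(1) d(1) by (metis zero_less_mult_pos2 mult_pos_pos zero_less_numeral)
    then show ?thesis
      using card_signed_sumset_AP_dvd[OF d(1) m _ assms(4)] d by simp
  next
    case False
    then show ?thesis
      using card_signed_sumset_AP_not_dvd[OF assms(1) d(1) False, of h] assms(4) d by simp
  qed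
qed

section \<open>The general bound and its sharpness\<close>

text \<open>Induction by removing the maximum, starting from triples. With \<open>k = n + 3\<close>
  the bound equals \<open>2 * h * k - h + 1\<close>.\<close>

lemma card_signed_sumset_ge:
  assumes "finite A" "card A = n + 3" "\<And>a. a \<in> A \<Longrightarrow> a > 0" "h \<ge> 3"
  shows "5 * h + 1 + 2 * h * n \<le> card (signed_sumset h A)"
  using assms(1-3)
proof (induction n arbitrary: A)
  case 0
  define xs where "xs = sorted_list_of_set A"
  have xs: "set xs = A" "length xs = 3" "sorted_wrt (<) xs"
    using 0 by (simp_all add: xs_def)
  then obtain a b c where abc: "xs = [a, b, c]"
    by (auto simp: numeral_eq_Suc length_Suc_conv)
  then have "A = {a, b, c}" "a < b" "b < c"
    using xs by auto
  then show ?case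
    using card_signed_sumset_triple[of a b c h] 0 assms(4) by simp
next
  case (Suc n)
  define M where "M = Max A"
  define B where "B = A - {M}"
  have "A \<noteq> {}"
    using Suc.prems(2) by auto
  then have M: "M \<in> A"
    using Suc.prems(1) by (simp add: M_def)
  have B: "finite B" "card B = n + 3" "\<And>b. b \<in> B \<Longrightarrow> b > 0"
    using Suc.prems M by (auto simp: B_def)
  define m where "m = Max B"
  have "B \<noteq> {}"
    using B(2) by auto
  then have m: "m \<in> B"
    using B(1) by (simp add: m_def)
  have "m < M"
    using m Suc.prems(1) by (simp add: B_def M_def order.not_eq_order_implies_strict)
  moreover have "\<bar>b\<bar> \<le> m" if "b \<in> B" for b
    using that B(1) B(3)[OF that] by (simp add: m_def)
  ultimately have "card (signed_sumset h B) + 2 * h \<le> card (signed_sumset h (insert M B))"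
    using B m by (intro signed_sumset_insert_max) auto
  moreover have "insert M B = A"
    using M by (auto simp: B_def)
  ultimately show ?case
    using Suc.IH[OF B] by simp
qed

section \<open>Sharpness for odd numbers\<close>

lemma signed_sumset_parity:
  assumes "x \<in> signed_sumset h A" "finite A" "\<And>a. a \<in> A \<Longrightarrow> odd a"
  shows "even (x - int h)"
proof -
  obtain l where l: "x = (\<Sum>a\<in>A. l a * a)" "(\<Sum>a\<in>A. \<bar>l a\<bar>) = int h"
    using assms by (auto simp: signed_sumset_def)
  have "x - int h = (\<Sum>a\<in>A. l a * a - \<bar>l a\<bar>)"
    using l by (simp add: sum_subtractf)
  \<comment> \<open>For odd \<open>a\<close>, both \<open>l a * a\<close> and
    \<open>\<bar>l a\<bar>\<close> have the parity of \<open>l a\<close>.\<close>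
  also have "even \<dots>"
    using assms(3) by (intro dvd_sum) simp
  finally show ?thesis .
qed

text \<open>All sums lie between \<open>- (int h * M)\<close> and \<open>int h * M\<close> and share
  the parity of the endpoints, which leaves \<open>int h * M + 1\<close> candidates.\<close>

lemma card_signed_sumset_odd_le:
  assumes "finite A" "\<And>a. a \<in> A \<Longrightarrow> odd a" "\<And>a. a \<in> A \<Longrightarrow> \<bar>a\<bar> \<le> M" "odd M" "M > 0"
  shows "int (card (signed_sumset h A)) \<le> int h * M + 1"
proof -
  have "signed_sumset h A \<subseteq> (\<lambda>n. 2 * n - int h * M) ` {0..int h * M}"
  proof
    fix x assume x: "x \<in> signed_sumset h A"
    have "even (x + int h * M)"
      using signed_sumset_parity[OF x assms(1,2)] assms(4) by simp
    then obtain n where "x + int h * M = 2 * n"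
      by (elim evenE)
    then show "x \<in> (\<lambda>n. 2 * n - int h * M) ` {0..int h * M}"
      using signed_sumset_abs_le[OF x assms(3)] by (intro image_eqI[of _ _ n]) auto
  qed
  then have "card (signed_sumset h A) \<le> card {0..int h * M}"
    by (intro surj_card_le) auto
  then have "int (card (signed_sumset h A)) \<le> int (card {0..int h * M})"
    by (simp only: of_nat_le_iff)
  also have "\<dots> = int h * M + 1"
  proof -
    have "0 \<le> int h * M"
      using assms(5) by simp
    then show ?thesis
      by simp
  qed
  finally show ?thesis .
qed

theorem theorem3:
  fixes h k :: nat
  assumes "h \<ge> 3" and "k \<ge> 3"
  shows "(\<forall>A :: int set. finite A \<and> card A = k \<and> (\<forall>a\<in>A. a > 0) \<longrightarrow>
            int (card (signed_sumset h A)) \<ge> 2 * int h * int k - int h + 1)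
       \<and> int (card (signed_sumset h {2 * int i + 1 | i :: nat. i < k})) = 2 * int h * int k - int h + 1"
proof -
  have lower: "2 * int h * int k - int h + 1 \<le> int (card (signed_sumset h A))"
    if A: "finite A" "card A = k" "\<forall>a\<in>A. a > 0" for A
  proof -
    obtain n where n: "k = n + 3"
      using assms(2) by (metis add.commute le_Suc_ex)
    have "5 * h + 1 + 2 * h * n \<le> card (signed_sumset h A)"
      using A n assms(1) by (intro card_signed_sumset_ge) auto
    then have "int (5 * h + 1 + 2 * h * n) \<le> int (card (signed_sumset h A))"
      by (simp only: of_nat_le_iff)
    then show ?thesis
      using n by (simp add: algebra_simps)
  qed
  define D where "D = {2 * int i + 1 | i :: nat. i < k}"
  have D: "D = (\<lambda>i. 2 * int i + 1) ` {..<k}"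
    by (auto simp: D_def)
  then have "finite D" "card D = k" "\<forall>a\<in>D. a > 0"
    by (auto simp: card_image inj_on_def)
  then have "2 * int h * int k - int h + 1 \<le> int (card (signed_sumset h D))"
    by (rule lower)
  \<comment> \<open>Here \<open>M = 2 * int k - 1\<close>, the largest element of
    \<open>D\<close>.\<close>
  moreover have "int (card (signed_sumset h D)) \<le> int h * (2 * int k - 1) + 1"
    using assms(2) by (intro card_signed_sumset_odd_le) (auto simp: D)
  ultimately have "int (card (signed_sumset h D)) = 2 * int h * int k - int h + 1"
    by (simp add: algebra_simps)
  then show ?thesis
    using lower unfolding D_def by blast
qed

end
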